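(* Let $P$ be an MCCS term. There is an execution $P\to^*1$ if and only if $\lfloor P\rfloor\multimap\lfloor 1\rfloor$ is provable in MLL (without modality rules) for some instantiation of the propositional variables.
   Context: MCCS terms are generated by $P,Q ::= 1 \mid P\parallel Q \mid a.P \mid \bar a.P$, with $a$ ranging over channel names. Structural congruence $\equiv$ is the smallest congruence making $\parallel$ associative and commutative with $1$ neutral. Execution $\to$ is the relation on terms up to $\equiv$ generated by $\bar a.P\parallel a.Q\parallel R\to P\parallel Q\parallel R$; $\to^*$ is its reflexive transitive closure. MLLa formulas: $A,B ::= \alpha \mid \alpha^\perp \mid A\otimes B \mid A⅋B \mid \mathsf{M}^+_a A \mid \mathsf{M}^-_a A$ ($\alpha$ propositional variables, $a$ channel names), with negation $(\alpha)^\perp=\alpha^\perp$, $(\alpha^\perp)^\perp=\alpha$, $(A\otimes B)^\perp=A^\perp⅋B^\perp$, $(A⅋B)^\perp=A^\perp\otimes B^\perp$, $(\mathsf M^+_aA)^\perp=\mathsf M^-_a(A^\perp)$, $(\mathsf M^-_aA)^\perp=\mathsf M^+_a(A^\perp)$, and $A\multimap B:=A^\perp⅋B$. "Provable in MLL" means derivable in the one-sided sequent calculus using only axiom $\vdash A^\perp,A$ (any formula $A$, possibly with modalities), cut, $\otimes$ (from $\vdash\Gamma,A$ and $\vdash B,\Delta$ infer $\vdash\Gamma,A\otimes B,\Delta$) and $⅋$ (from $\vdash\Gamma,A,B$ infer $\vdash\Gamma,A⅋B$) rules, without the modality introduction rules. An instantiation substitutes formulas for propositional variables. Asynchronous translation: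 $\lfloor 1\rfloor = \alpha^\perp⅋\alpha$, $\lfloor P\parallel Q\rfloor = \lfloor P\rfloor\otimes\lfloor Q\rfloor$, $\lfloor a.P\rfloor = \mathsf M^+_a\alpha^\perp⅋(\lfloor P\rfloor\otimes\alpha)$, $\lfloor \bar a.P\rfloor = (\lfloor P\rfloor\otimes\alpha^\perp)⅋\mathsf M^-_a\alpha$, where in each clause $\alpha$ is a fresh propositional variable (so the variables of $\lfloor P\rfloor$ and of $\lfloor 1\rfloor$ are distinct).
   Formalization: The instantiation may change only the variables of ⌊P⌋, and the variable of ⌊1⌋ stays fixed; if it too could be instantiated the claim fails: for the stuck term P = a.ā.1, taking M⁻_a α for it and α for all others makes ⌊P⌋⊸⌊1⌋ provable. *)

theory Defs
  imports "HOL-Library.Multiset"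
begin

datatype 'c mccs =
    One
  | Par "'c mccs" "'c mccs" (infixl "\<parallel>" 65)
  | In 'c "'c mccs"
  | Out 'c "'c mccs"

inductive scong :: "'c mccs \<Rightarrow> 'c mccs \<Rightarrow> bool" (infix "\<sim>" 50) where
  refl: "P \<sim> P"
| sym: "P \<sim> Q \<Longrightarrow> Q \<sim> P"
| trans: "P \<sim> Q \<Longrightarrow> Q \<sim> R \<Longrightarrow> P \<sim> R"
| par: "P \<sim> P' \<Longrightarrow> Q \<sim> Q' \<Longrightarrow> P \<parallel> Q \<sim> P' \<parallel> Q'"
| inp: "P \<sim> Q \<Longrightarrow> In a P \<sim> In a Q"
| out: "P \<sim> Q \<Longrightarrow> Out a P \<sim> Out a Q"
| assoc: "(P \<parallel> Q) \<parallel> R \<sim> P \<parallel> (Q \<parallel> R)"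
| comm: "P \<parallel> Q \<sim> Q \<parallel> P"
| unit: "One \<parallel> P \<sim> P"

inductive step :: "'c mccs \<Rightarrow> 'c mccs \<Rightarrow> bool" where
  "S \<sim> Out a P \<parallel> In a Q \<parallel> R \<Longrightarrow> P \<parallel> Q \<parallel> R \<sim> T \<Longrightarrow> step S T"

(* Execution lives on terms up to structural congruence, so the reflexive case of the
   closure is structural congruence rather than syntactic equality. *)
definition steps :: "'c mccs \<Rightarrow> 'c mccs \<Rightarrow> bool" where
  "steps = (\<lambda>P Q. step P Q \<or> P \<sim> Q)\<^sup>*\<^sup>*"

datatype (vars: 'v, chans: 'c) mlla =
    Var 'v
  | NVar 'v
  | Tensor "('v, 'c) mlla" "('v, 'c) mlla"
  | Parr "('v, 'c) mlla" "('v, 'c) mlla"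
  | MPos 'c "('v, 'c) mlla"
  | MNeg 'c "('v, 'c) mlla"

primrec neg :: "('v, 'c) mlla \<Rightarrow> ('v, 'c) mlla" where
  "neg (Var x) = NVar x"
| "neg (NVar x) = Var x"
| "neg (Tensor A B) = Parr (neg A) (neg B)"
| "neg (Parr A B) = Tensor (neg A) (neg B)"
| "neg (MPos a A) = MNeg a (neg A)"
| "neg (MNeg a A) = MPos a (neg A)"

definition lolli :: "('v, 'c) mlla \<Rightarrow> ('v, 'c) mlla \<Rightarrow> ('v, 'c) mlla" where
  "lolli A B = Parr (neg A) B"

primrec inst :: "('v \<Rightarrow> ('w, 'c) mlla) \<Rightarrow> ('v, 'c) mlla \<Rightarrow> ('w, 'c) mlla" where
  "inst \<sigma> (Var x) = \<sigma> x"
| "inst \<sigma> (NVar x) = neg (\<sigma> x)"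
| "inst \<sigma> (Tensor A B) = Tensor (inst \<sigma> A) (inst \<sigma> B)"
| "inst \<sigma> (Parr A B) = Parr (inst \<sigma> A) (inst \<sigma> B)"
| "inst \<sigma> (MPos a A) = MPos a (inst \<sigma> A)"
| "inst \<sigma> (MNeg a A) = MNeg a (inst \<sigma> A)"

(* Sequents are multisets, which makes the exchange rule implicit. There are no rules for
   the modalities: a modal formula can only be introduced by an axiom. *)
inductive MLL :: "('v, 'c) mlla multiset \<Rightarrow> bool" where
  ax: "MLL {#neg A, A#}"
| cut: "MLL (add_mset A \<Gamma>) \<Longrightarrow> MLL (add_mset (neg A) \<Delta>) \<Longrightarrow> MLL (\<Gamma> + \<Delta>)"
| tensor: "MLL (add_mset A \<Gamma>) \<Longrightarrow> MLL (add_mset B \<Delta>) \<Longrightarrow> MLL (add_mset (Tensor A B) (\<Gamma> + \<Delta>))"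
| parr: "MLL (add_mset A (add_mset B \<Gamma>)) \<Longrightarrow> MLL (add_mset (Parr A B) \<Gamma>)"

(* async P F: F is the asynchronous translation of P, for some choice of fresh variables.
   The translation is only determined up to that choice, hence a relation. *)
inductive async :: "'c mccs \<Rightarrow> (nat, 'c) mlla \<Rightarrow> bool" where
  One: "async One (Parr (NVar x) (Var x))"
| Par: "async P F \<Longrightarrow> async Q G \<Longrightarrow> vars F \<inter> vars G = {} \<Longrightarrow> async (P \<parallel> Q) (Tensor F G)"
| In: "async P F \<Longrightarrow> x \<notin> vars F
    \<Longrightarrow> async (In a P) (Parr (MPos a (NVar x)) (Tensor F (Var x)))"
| Out: "async P F \<Longrightarrow> x \<notin> vars F
    \<Longrightarrow> async (Out a P) (Parr (Tensor F (NVar x)) (MNeg a (Var x)))"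

(* When asking whether some instance of F \<multimap> G is provable, for async P F and async One G,
   the goal G has to keep its own variable. Otherwise that variable can be instantiated by a
   modal formula acting as a catalyst: with MNeg a A for it, an instance becomes provable for
   P = In a (Out a One), which has no execution step. *)

lemma finite_vars: "finite (vars F)"
  by (induction F) auto

lemma async_exists: "finite X \<Longrightarrow> \<exists>F. async P F \<and> vars F \<inter> X = {}"
proof (induction P arbitrary: X)
  case One
  then obtain x where "x \<notin> X" using ex_new_if_finite infinite_UNIV_nat by blast
  then show ?case using async.One[of x] by fastforce
next
  case (Par P Q)
  obtain F where F: "async P F" "vars F \<inter> X = {}" using Par by blast
  have "finite (vars F \<union> X)" using Par.prems finite_vars by blast
  then obtain G where "async Q G" "vars G \<inter> (vars F \<union> X) = {}" using Par.IH(2) by blast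
  then have "async (P \<parallel> Q) (Tensor F G) \<and> vars (Tensor F G) \<inter> X = {}"
    using F by (auto intro!: async.Par)
  then show ?case by blast
next
  case (In a P)
  obtain F where F: "async P F" "vars F \<inter> X = {}" using In by blast
  have "finite (vars F \<union> X)" using In.prems finite_vars by blast
  then obtain x where "x \<notin> vars F \<union> X" using ex_new_if_finite infinite_UNIV_nat by blast
  then show ?case using F async.In[of P F x a] by fastforce
next
  case (Out a P)
  obtain F where F: "async P F" "vars F \<inter> X = {}" using Out by blast
  have "finite (vars F \<union> X)" using Out.prems finite_vars by blast
  then obtain x where "x \<notin> vars F \<union> X" using ex_new_if_finite infinite_UNIV_nat by blast
  then show ?case using F async.Out[of P F x a] by fastforce
qed

end

theory Submission
  imports Defs "HOL-Library.Set_Algebras"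
begin

text \<open>
  A proof of the formula yields an execution by phase semantics: formulas are interpreted as sets
  of processes closed under biorthogonality, the pole being the set of processes that execute to
  \<open>1\<close>. With \<open>M\<^sup>-\<^sub>a A\<close> generated by the processes \<open>\<bar>a.P \<parallel> R\<close> such that \<open>P \<parallel> R\<close> is in \<open>A\<close>,
  every process belongs to the interpretation of each instance of its translation, and the provable
  implication, with the pole for the variable of \<open>\<lfloor>1\<rfloor>\<close>, places \<open>P\<close> in the pole.

  Conversely, instances are transported backwards along an execution: when \<open>\<bar>a.P\<close> meets \<open>a.Q\<close>,
  instantiate the two variables of the prefixes by the instance already chosen for \<open>P\<close>.
\<close>

section \<open>Instances of translations\<close>

text \<open>The instances of a translation, described without variables. Since the variables of a
  translation are fresh, each \<open>One\<close> and each prefix may choose its own \<open>C\<close>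
  independently of all others.\<close>

inductive transl :: "'c mccs \<Rightarrow> ('v, 'c) mlla \<Rightarrow> bool" where
  One: "transl One (Parr (neg C) C)"
| Par: "transl P A \<Longrightarrow> transl Q B \<Longrightarrow> transl (P \<parallel> Q) (Tensor A B)"
| In: "transl P A \<Longrightarrow> transl (In a P) (Parr (MPos a (neg C)) (Tensor A C))"
| Out: "transl P A \<Longrightarrow> transl (Out a P) (Parr (Tensor A (neg C)) (MNeg a C))"

inductive_cases transl_OneE: "transl One A"
inductive_cases transl_ParE: "transl (P \<parallel> Q) A"
inductive_cases transl_InE: "transl (In a P) A"
inductive_cases transl_OutE: "transl (Out a P) A"

lemma neg_neg [simp]: "neg (neg A) = A"
  by (induction A) auto

lemma inst_neg: "inst \<sigma> (neg A) = neg (inst \<sigma> A)"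
  by (induction A) auto

lemma inst_cong: "(\<And>x. x \<in> vars A \<Longrightarrow> \<sigma> x = \<tau> x) \<Longrightarrow> inst \<sigma> A = inst \<tau> A"
  by (induction A) auto

lemma async_imp_transl: "async P F \<Longrightarrow> transl P (inst \<sigma> F)"
  by (induction rule: async.induct) (auto intro: transl.intros)

lemma transl_imp_inst:
  assumes "async P F" "transl P A"
  shows "\<exists>\<sigma>. inst \<sigma> F = A"
  using assms
proof (induction arbitrary: A rule: async.induct)
  case (One x)
  then obtain C where "A = Parr (neg C) C" by (auto elim: transl_OneE)
  then have "inst (\<lambda>_. C) (Parr (NVar x) (Var x)) = A" by simp
  then show ?case by blast
next
  case (Par P F Q G)
  obtain B C where A: "A = Tensor B C" and "transl P B" "transl Q C"
    using Par.prems by (auto elim: transl_ParE)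
  then obtain \<sigma> \<tau> where *: "inst \<sigma> F = B" "inst \<tau> G = C" using Par.IH by blast
  \<comment> \<open>Disjointness of \<open>vars F\<close> and \<open>vars G\<close> permits gluing
    the two substitutions.\<close>
  let ?\<rho> = "\<lambda>x. if x \<in> vars F then \<sigma> x else \<tau> x"
  have "inst ?\<rho> F = inst \<sigma> F" by (rule inst_cong) simp
  moreover have "inst ?\<rho> G = inst \<tau> G" using Par.hyps by (intro inst_cong) auto
  ultimately have "inst ?\<rho> (Tensor F G) = A" using A * by simp
  then show ?case by blast
next
  case (In P F x a)
  obtain B C where A: "A = Parr (MPos a (neg C)) (Tensor B C)" and "transl P B"
    using In.prems by (auto elim: transl_InE)
  then obtain \<sigma> where "inst \<sigma> F = B" using In.IH by blast
  moreover have "inst (\<sigma>(x := C)) F = inst \<sigma> F" using In.hyps by (intro inst_cong) auto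
  ultimately have "inst (\<sigma>(x := C)) (Parr (MPos a (NVar x)) (Tensor F (Var x))) = A"
    using A by simp
  then show ?case by blast
next
  case (Out P F x a)
  obtain B C where A: "A = Parr (Tensor B (neg C)) (MNeg a C)" and "transl P B"
    using Out.prems by (auto elim: transl_OutE)
  then obtain \<sigma> where "inst \<sigma> F = B" using Out.IH by blast
  moreover have "inst (\<sigma>(x := C)) F = inst \<sigma> F" using Out.hyps by (intro inst_cong) auto
  ultimately have "inst (\<sigma>(x := C)) (Parr (Tensor F (NVar x)) (MNeg a (Var x))) = A"
    using A by simp
  then show ?case by blast
qed

section \<open>From executions to proofs\<close>

definition entails :: "('v, 'c) mlla \<Rightarrow> ('v, 'c) mlla \<Rightarrow> bool" (infix "\<turnstile>" 50) where
  "A \<turnstile> B \<longleftrightarrow> MLL {#neg A, B#}"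

lemma entails_refl [simp]: "A \<turnstile> A"
  by (simp add: entails_def MLL.ax)

lemma entails_trans [trans]:
  assumes "A \<turnstile> B" "B \<turnstile> C"
  shows "A \<turnstile> C"
proof -
  have "MLL (add_mset B {#neg A#})" using assms(1) by (simp add: entails_def add_mset_commute)
  then have "MLL ({#neg A#} + {#C#})"
    using assms(2) unfolding entails_def by (rule MLL.cut)
  then show ?thesis by (simp add: entails_def add_mset_commute)
qed

lemma entails_Tensor:
  assumes "A \<turnstile> A'" "B \<turnstile> B'"
  shows "Tensor A B \<turnstile> Tensor A' B'"
proof -
  have "MLL (add_mset A' {#neg A#})" "MLL (add_mset B' {#neg B#})"
    using assms by (simp_all add: entails_def add_mset_commute)
  from MLL.tensor[OF this]
  have "MLL (add_mset (neg A) (add_mset (neg B) {#Tensor A' B'#}))"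
    by (simp add: add_mset_commute)
  then show ?thesis unfolding entails_def neg.simps by (rule MLL.parr)
qed

lemma entails_neg: "neg B \<turnstile> neg A \<longleftrightarrow> A \<turnstile> B"
  by (simp add: entails_def add_mset_commute)

lemma entails_Parr: "A \<turnstile> A' \<Longrightarrow> B \<turnstile> B' \<Longrightarrow> Parr A B \<turnstile> Parr A' B'"
  using entails_Tensor[of "neg A'" "neg A" "neg B'" "neg B"]
    entails_neg[of "Parr A' B'" "Parr A B"] by (simp add: entails_neg)

lemma entails_Tensor_commute: "Tensor A B \<turnstile> Tensor B A"
proof -
  have "MLL (add_mset (Tensor B A) ({#neg B#} + {#neg A#}))"
    by (rule MLL.tensor) (use MLL.ax in \<open>simp_all add: add_mset_commute\<close>)
  then have "MLL (add_mset (neg A) (add_mset (neg B) {#Tensor B A#}))"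
    by (simp add: add_mset_commute)
  then show ?thesis unfolding entails_def neg.simps by (rule MLL.parr)
qed

lemma entails_Tensor_assoc: "Tensor (Tensor A B) C \<turnstile> Tensor A (Tensor B C)"
proof -
  have ax: "MLL (add_mset X {#neg X#})" for X :: "('a, 'b) mlla"
    using MLL.ax by (simp add: add_mset_commute)
  have "MLL (add_mset (Tensor A (Tensor B C)) ({#neg A#} + ({#neg B#} + {#neg C#})))"
    by (intro MLL.tensor ax)
  then have "MLL (add_mset (neg A) (add_mset (neg B) {#neg C, Tensor A (Tensor B C)#}))"
    by (simp add: add_mset_commute)
  then have "MLL (add_mset (Parr (neg A) (neg B)) (add_mset (neg C) {#Tensor A (Tensor B C)#}))"
    by (rule MLL.parr)
  then show ?thesis unfolding entails_def neg.simps by (rule MLL.parr)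
qed

lemma entails_Tensor_assoc': "Tensor A (Tensor B C) \<turnstile> Tensor (Tensor A B) C"
proof -
  have "Tensor A (Tensor B C) \<turnstile> Tensor (Tensor B C) A" by (rule entails_Tensor_commute)
  also have "\<dots> \<turnstile> Tensor B (Tensor C A)" by (rule entails_Tensor_assoc)
  also have "\<dots> \<turnstile> Tensor (Tensor C A) B" by (rule entails_Tensor_commute)
  also have "\<dots> \<turnstile> Tensor C (Tensor A B)" by (rule entails_Tensor_assoc)
  also have "\<dots> \<turnstile> Tensor (Tensor A B) C" by (rule entails_Tensor_commute)
  finally show ?thesis .
qed

lemma MLL_identity: "MLL {#Parr (neg A) A#}"
  by (intro MLL.parr MLL.ax)

lemma entails_identity_Tensor: "A \<turnstile> Tensor (Parr (neg C) C) A"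
proof -
  have "MLL (add_mset (Tensor (Parr (neg C) C) A) ({#} + {#neg A#}))"
    by (rule MLL.tensor) (use MLL.ax in \<open>simp_all add: add_mset_commute MLL_identity\<close>)
  then show ?thesis by (simp add: entails_def add_mset_commute)
qed

lemma entails_modus_ponens: "Tensor (Parr (neg A) B) A \<turnstile> B"
proof -
  have "MLL (add_mset (Tensor A (neg B)) ({#neg A#} + {#B#}))"
    by (rule MLL.tensor) (use MLL.ax in \<open>simp_all add: add_mset_commute\<close>)
  then have "MLL (add_mset (Tensor A (neg B)) (add_mset (neg A) {#B#}))"
    by (simp add: add_mset_commute)
  then show ?thesis unfolding entails_def neg.simps neg_neg by (rule MLL.parr)
qed

text \<open>With both prefix variables set to \<open>A\<close>, the identity
  \<open>Parr (neg A) A\<close> cancels \<open>Tensor A (neg A)\<close>. The remaining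
  \<open>MNeg a A\<close> is cut against \<open>MPos a (neg A)\<close> by an axiom, so no modality
  rule is involved, and \<open>Tensor B A\<close> is released.\<close>

lemma entails_communication:
  "Tensor (Parr (Tensor A (neg A)) (MNeg a A)) (Parr (MPos a (neg A)) (Tensor B A)) \<turnstile> Tensor A B"
proof -
  let ?O = "Tensor (Parr (neg A) A) (MPos a (neg A))"
  let ?I = "Tensor (MNeg a A) (Parr (neg B) (neg A))"
  have "MLL (add_mset ?O ({#} + {#MNeg a A#}))"
    using MLL.ax[of "MNeg a A"] by (intro MLL.tensor MLL_identity[simplified]) simp
  then have "MLL (add_mset (MNeg a A) {#?O#})" by (simp add: add_mset_commute)
  moreover have "MLL (add_mset (Parr (neg B) (neg A)) {#Tensor A B#})"
    using entails_Tensor_commute[of B A] by (simp add: entails_def)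
  ultimately have "MLL (add_mset ?I ({#?O#} + {#Tensor A B#}))" by (rule MLL.tensor)
  then have "MLL (add_mset ?O (add_mset ?I {#Tensor A B#}))" by (simp add: add_mset_commute)
  then show ?thesis unfolding entails_def neg.simps neg_neg by (rule MLL.parr)
qed

text \<open>Instances travel against the direction of execution: the one for \<open>P\<close> is
  chosen after the one for \<open>Q\<close>. The \<open>itself\<close> argument records
  \<open>'v\<close>, which does not occur in the types of \<open>P\<close> and
  \<open>Q\<close>.\<close>

definition sim :: "'v itself \<Rightarrow> 'c mccs \<Rightarrow> 'c mccs \<Rightarrow> bool" where
  "sim _ P Q \<longleftrightarrow> (\<forall>A :: ('v, 'c) mlla. transl Q A \<longrightarrow> (\<exists>B. transl P B \<and> B \<turnstile> A))"

lemma simI: "(\<And>A :: ('v, 'c) mlla. transl Q A \<Longrightarrow> \<exists>B. transl P B \<and> B \<turnstile> A) \<Longrightarrow> sim TYPE('v) P Q"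
  by (simp add: sim_def)

lemma sim_refl: "sim TYPE('v) P P"
  by (rule simI) (blast intro: entails_refl)

lemma sim_trans [trans]: "sim TYPE('v) P Q \<Longrightarrow> sim TYPE('v) Q R \<Longrightarrow> sim TYPE('v) P R"
  unfolding sim_def by (meson entails_trans)

lemma sim_Par: "sim TYPE('v) P P' \<Longrightarrow> sim TYPE('v) Q Q' \<Longrightarrow> sim TYPE('v) (P \<parallel> Q) (P' \<parallel> Q')"
  unfolding sim_def by (fast elim!: transl_ParE intro: transl.Par entails_Tensor)

lemma sim_In:
  assumes "sim TYPE('v) P Q"
  shows "sim TYPE('v) (In a P) (In a Q)"
proof (rule simI)
  fix X :: "('v, 'a) mlla"
  assume "transl (In a Q) X"
  then obtain A C where X: "X = Parr (MPos a (neg C)) (Tensor A C)" and "transl Q A"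
    by (auto elim: transl_InE)
  then obtain B where "transl P B" "B \<turnstile> A" using assms by (auto simp: sim_def)
  then show "\<exists>Y. transl (In a P) Y \<and> Y \<turnstile> X"
    unfolding X by (meson entails_Parr entails_Tensor entails_refl transl.In)
qed

lemma sim_Out:
  assumes "sim TYPE('v) P Q"
  shows "sim TYPE('v) (Out a P) (Out a Q)"
proof (rule simI)
  fix X :: "('v, 'a) mlla"
  assume "transl (Out a Q) X"
  then obtain A C where X: "X = Parr (Tensor A (neg C)) (MNeg a C)" and "transl Q A"
    by (auto elim: transl_OutE)
  then obtain B where "transl P B" "B \<turnstile> A" using assms by (auto simp: sim_def)
  then show "\<exists>Y. transl (Out a P) Y \<and> Y \<turnstile> X"
    unfolding X by (meson entails_Parr entails_Tensor entails_refl transl.Out)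
qed

text \<open>\<open>sim\<close> is a preorder while \<open>scong\<close> has a symmetry rule, so the
  induction carries both directions.\<close>

lemma scong_imp_sim: "P \<sim> Q \<Longrightarrow> sim TYPE('v) P Q \<and> sim TYPE('v) Q P"
proof (induction rule: scong.induct)
  case (assoc P Q R)
  have "sim TYPE('v) (P \<parallel> Q \<parallel> R) (P \<parallel> (Q \<parallel> R))"
    by (rule simI) (blast elim!: transl_ParE intro: transl.Par entails_Tensor_assoc)
  moreover have "sim TYPE('v) (P \<parallel> (Q \<parallel> R)) (P \<parallel> Q \<parallel> R)"
    by (rule simI) (blast elim!: transl_ParE intro: transl.Par entails_Tensor_assoc')
  ultimately show ?case ..
next
  case (comm P Q)
  have "sim TYPE('v) (P \<parallel> Q) (Q \<parallel> P)" for P Q :: "'a mccs"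
    by (rule simI) (blast elim!: transl_ParE intro: transl.Par entails_Tensor_commute)
  then show ?case by blast
next
  case (unit P)
  \<comment> \<open>For an instance \<open>A\<close> of \<open>P\<close>, the variable of
    \<open>One\<close> is set to \<open>A\<close>, and modus ponens consumes
    \<open>Parr (neg A) A\<close>.\<close>
  have "sim TYPE('v) (One \<parallel> P) P"
    by (rule simI) (blast intro: transl.Par transl.One entails_modus_ponens)
  moreover have "sim TYPE('v) P (One \<parallel> P)"
    by (rule simI) (blast elim: transl_ParE transl_OneE intro: entails_identity_Tensor)
  ultimately show ?case ..
qed (blast intro: sim_refl sim_trans sim_Par sim_In sim_Out)+

lemma sim_communication: "sim TYPE('v) (Out a P \<parallel> In a Q) (P \<parallel> Q)"
proof (rule simI)
  fix X :: "('v, 'a) mlla"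
  assume "transl (P \<parallel> Q) X"
  then obtain A B where "X = Tensor A B" "transl P A" "transl Q B" by (auto elim: transl_ParE)
  then show "\<exists>Y. transl (Out a P \<parallel> In a Q) Y \<and> Y \<turnstile> X"
    by (metis transl.Par transl.Out transl.In entails_communication)
qed

lemma step_imp_sim: "step S T \<Longrightarrow> sim TYPE('v) S T"
proof (induction rule: step.induct)
  case (1 S a P Q R T)
  have "sim TYPE('v) S (Out a P \<parallel> In a Q \<parallel> R)" using 1(1) scong_imp_sim by blast
  also have "sim TYPE('v) (Out a P \<parallel> In a Q \<parallel> R) (P \<parallel> Q \<parallel> R)"
    by (intro sim_Par sim_communication sim_refl)
  also have "sim TYPE('v) (P \<parallel> Q \<parallel> R) T" using 1(2) scong_imp_sim by blast
  finally show ?case .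
qed

lemma steps_imp_sim: "steps S T \<Longrightarrow> sim TYPE('v) S T"
  unfolding steps_def
proof (induction rule: rtranclp_induct)
  case base
  show ?case by (rule sim_refl)
next
  case (step T U)
  then have "sim TYPE('v) T U" using step_imp_sim scong_imp_sim by blast
  with step.IH show ?case by (rule sim_trans)
qed

section \<open>From proofs to executions\<close>

lemma steps_scong_left: "P \<sim> Q \<Longrightarrow> steps Q R \<Longrightarrow> steps P R"
  unfolding steps_def by (rule converse_rtranclp_into_rtranclp) auto

lemma steps_step_left: "step P Q \<Longrightarrow> steps Q R \<Longrightarrow> steps P R"
  unfolding steps_def by (rule converse_rtranclp_into_rtranclp) auto

quotient_type 'c proc = "'c mccs" / scong
  by (rule equivpI) (auto intro!: reflpI sympI transpI intro: scong.refl scong.sym scong.trans)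

text \<open>With parallel composition as addition, sets of processes can be added pointwise and
  summed over a multiset sequent.\<close>

instantiation proc :: (type) comm_monoid_add
begin

lift_definition zero_proc :: "'a proc" is One .

lift_definition plus_proc :: "'a proc \<Rightarrow> 'a proc \<Rightarrow> 'a proc" is Par
  by (rule scong.par)

instance
  by standard (transfer, blast intro: scong.intros)+

end

lift_definition halts :: "'c proc \<Rightarrow> bool" is "\<lambda>P. steps P One"
  using steps_scong_left scong.sym by blast

lift_definition proc :: "'c mccs \<Rightarrow> 'c proc" is "\<lambda>P. P" .

lift_definition pout :: "'c \<Rightarrow> 'c proc \<Rightarrow> 'c proc" is Out by (rule scong.out)

lemma halts_0 [simp]: "halts 0"
  by transfer (simp add: steps_def)

text \<open>Closure of the pole under backward communication, through which the dynamics enters the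
  model.\<close>

lemma halts_communication: "halts (p + proc Q + r) \<Longrightarrow> halts (pout a p + proc (In a Q) + r)"
  by transfer (blast intro: steps_step_left step.intros scong.refl)

section \<open>Phase semantics\<close>

definition orth :: "'c proc set \<Rightarrow> 'c proc set" where
  "orth S = {p. \<forall>q \<in> S. halts (p + q)}"

abbreviation pole :: "'c proc set" where
  "pole \<equiv> Collect halts"

text \<open>The Galois connection of orthogonality, from which the soundness of each rule is read
  off.\<close>

lemma plus_subset_pole_iff: "S + T \<subseteq> pole \<longleftrightarrow> S \<subseteq> orth T"
  by (auto simp: orth_def set_plus_def)

lemma plus_subset_pole_iff': "S + T \<subseteq> pole \<longleftrightarrow> T \<subseteq> orth S"
  by (simp add: add.commute[of S] plus_subset_pole_iff)

lemma orth_orth_ge: "S \<subseteq> orth (orth S)"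
  unfolding plus_subset_pole_iff'[symmetric] by (simp add: plus_subset_pole_iff)

lemma orth_antimono: "S \<subseteq> T \<Longrightarrow> orth T \<subseteq> orth S"
  by (auto simp: orth_def)

lemma orth_orth_orth [simp]: "orth (orth (orth S)) = orth S"
  by (simp add: orth_antimono orth_orth_ge subset_antisym)

text \<open>The spectator \<open>r\<close> makes room for a test that stays outside the prefix, as
  \<open>q\<close> does in the output case of \<open>transl_imp_mem_sem\<close>.\<close>

definition outs :: "'c \<Rightarrow> 'c proc set \<Rightarrow> 'c proc set" where
  "outs a S = {pout a p + r |p r. p + r \<in> S}"

text \<open>Every variable denotes the pole, written \<open>orth {0}\<close> so that each clause is
  visibly an orthogonal and hence closed.\<close>

primrec sem :: "('v, 'c) mlla \<Rightarrow> 'c proc set" where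
  "sem (Var x) = orth {0}"
| "sem (NVar x) = orth (orth {0})"
| "sem (Tensor A B) = orth (orth (sem A + sem B))"
| "sem (Parr A B) = orth (orth (sem A) + orth (sem B))"
| "sem (MPos a A) = orth (outs a (orth (sem A)))"
| "sem (MNeg a A) = orth (orth (outs a (sem A)))"

lemma orth_orth_sem [simp]: "orth (orth (sem A)) = sem A"
  by (cases A) simp_all

lemma sem_neg: "sem (neg A) = orth (sem A)"
  by (induction A) simp_all

text \<open>A sequent is read as a par: tests for all of its formulas, run together, halt. Moving
  one formula \<open>A\<close> across the Galois connection places the sum of the other orthogonals
  inside \<open>sem A\<close>, the form in which cut and tensor combine premises.\<close>

lemma MLL_sound: "MLL \<Gamma> \<Longrightarrow> (\<Sum>A \<in># \<Gamma>. orth (sem A)) \<subseteq> pole"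
proof (induction rule: MLL.induct)
  case (ax A)
  then show ?case by (simp add: sem_neg plus_subset_pole_iff)
next
  case (cut A \<Gamma> \<Delta>)
  then have "(\<Sum>A \<in># \<Gamma>. orth (sem A)) \<subseteq> sem A" "(\<Sum>A \<in># \<Delta>. orth (sem A)) \<subseteq> orth (sem A)"
    by (simp_all add: sem_neg plus_subset_pole_iff')
  then have "(\<Sum>A \<in># \<Gamma> + \<Delta>. orth (sem A)) \<subseteq> sem A + orth (sem A)"
    by (simp add: set_plus_mono2)
  also have "\<dots> \<subseteq> pole" by (simp add: plus_subset_pole_iff)
  finally show ?case .
next
  case (tensor A \<Gamma> B \<Delta>)
  then have "(\<Sum>A \<in># \<Gamma>. orth (sem A)) \<subseteq> sem A" "(\<Sum>A \<in># \<Delta>. orth (sem A)) \<subseteq> sem B"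
    by (simp_all add: plus_subset_pole_iff')
  then have "(\<Sum>A \<in># \<Gamma> + \<Delta>. orth (sem A)) \<subseteq> sem A + sem B"
    by (simp add: set_plus_mono2)
  also have "\<dots> \<subseteq> orth (orth (sem A + sem B))" by (rule orth_orth_ge)
  finally show ?case by (simp add: plus_subset_pole_iff')
next
  case (parr A B \<Gamma>)
  then show ?case by (simp add: plus_subset_pole_iff' flip: add.assoc)
qed

lemma mem_sem_ParrI:
  "(\<And>q r. q \<in> orth (sem A) \<Longrightarrow> r \<in> orth (sem B) \<Longrightarrow> halts (p + (q + r))) \<Longrightarrow> p \<in> sem (Parr A B)"
  by (auto simp: orth_def set_plus_def)

lemma mem_orthD: "p \<in> orth S \<Longrightarrow> q \<in> S \<Longrightarrow> halts (p + q)"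
  by (simp add: orth_def)

lemma mem_sem_TensorI: "p \<in> sem A \<Longrightarrow> q \<in> sem B \<Longrightarrow> p + q \<in> sem (Tensor A B)"
  using orth_orth_ge[of "sem A + sem B"] by auto

lemma transl_imp_mem_sem: "transl P A \<Longrightarrow> proc P \<in> sem A"
proof (induction rule: transl.induct)
  case (One C)
  have "proc One = (0 :: 'a proc)" by transfer (rule scong.refl)
  then show ?case
    by (intro mem_sem_ParrI) (simp add: sem_neg, metis add.commute mem_orthD)
next
  case (Par P A Q B)
  have "proc (P \<parallel> Q) = proc P + proc Q" by transfer (rule scong.refl)
  then show ?case using Par mem_sem_TensorI by metis
next
  case (In P A a C)
  show ?case
  proof (rule mem_sem_ParrI)
    fix q r
    assume q: "q \<in> orth (sem (MPos a (neg C)))" and r: "r \<in> orth (sem (Tensor A C))"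
    \<comment> \<open>As \<open>q\<close> lies in the biorthogonal of \<open>outs a (sem C)\<close>,
      it suffices to test against generators \<open>pout a p + t\<close>, which can communicate with
      the input.\<close>
    have "proc (In a P) + r \<in> orth (outs a (sem C))"
      unfolding orth_def
    proof (intro CollectI ballI)
      fix s
      assume "s \<in> outs a (sem C)"
      then obtain p t where s: "s = pout a p + t" and "p + t \<in> sem C" by (auto simp: outs_def)
      then have "halts (r + (proc P + (p + t)))"
        using In.IH r mem_sem_TensorI mem_orthD by blast
      then have "halts (pout a p + proc (In a P) + (r + t))"
        by (intro halts_communication) (simp add: ac_simps)
      then show "halts (proc (In a P) + r + s)" by (simp add: s ac_simps)
    qed
    moreover have "q \<in> orth (orth (outs a (sem C)))" using q by (simp add: sem_neg)
    ultimately have "halts (q + (proc (In a P) + r))" by (blast intro: mem_orthD)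
    then show "halts (proc (In a P) + (q + r))" by (simp add: ac_simps)
  qed
next
  case (Out P A a C)
  show ?case
  proof (rule mem_sem_ParrI)
    fix q r
    assume q: "q \<in> orth (sem (Tensor A (neg C)))" and r: "r \<in> orth (sem (MNeg a C))"
    \<comment> \<open>This set is \<open>sem C\<close>, so guarding \<open>proc P\<close> and
      keeping \<open>q\<close> as spectator yields a generator of
      \<open>sem (MNeg a C)\<close>.\<close>
    have "proc P + q \<in> orth (sem (neg C))"
      unfolding orth_def
    proof (intro CollectI ballI)
      fix s
      assume "s \<in> sem (neg C)"
      then have "halts (q + (proc P + s))"
        using Out.IH q mem_sem_TensorI mem_orthD by blast
      then show "halts (proc P + q + s)" by (simp add: ac_simps)
    qed
    then have "pout a (proc P) + q \<in> outs a (sem C)" by (auto simp: sem_neg outs_def)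
    moreover have "r \<in> orth (outs a (sem C))" using r by simp
    ultimately have "halts (r + (pout a (proc P) + q))" by (blast intro: mem_orthD)
    moreover have "proc (Out a P) = pout a (proc P)" by transfer (rule scong.refl)
    ultimately show "halts (proc (Out a P) + (q + r))" by (simp add: ac_simps)
  qed
qed

lemma transl_MLL_imp_steps:
  assumes "transl P A" "MLL {#lolli A (Parr (NVar x) (Var x))#}"
  shows "steps P One"
proof -
  \<comment> \<open>Here the goal must keep its variable: \<open>0\<close> lies in the pole and in
    its orthogonal, so it tests the goal. With \<open>C\<close> for \<open>x\<close>, it would have
    to lie in both \<open>sem C\<close> and \<open>orth (sem C)\<close>.\<close>
  have "0 \<in> sem (Var x)" "0 \<in> sem (NVar x)"
    by (auto simp: orth_def)
  then have "0 + 0 \<in> sem (Tensor (Var x) (NVar x))" by (rule mem_sem_TensorI)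
  then have "proc P + 0 \<in> sem (Tensor A (Tensor (Var x) (NVar x)))"
    using transl_imp_mem_sem[OF assms(1)] by (intro mem_sem_TensorI) simp_all
  then have "proc P \<in> orth (sem (lolli A (Parr (NVar x) (Var x))))"
    by (simp add: lolli_def sem_neg)
  then have "halts (proc P)" using MLL_sound[OF assms(2)] by auto
  then show ?thesis by transfer
qed

theorem theorem15:
  fixes P :: "'c mccs" and F G :: "(nat, 'c) mlla"
  assumes "async P F" and "async One G" and "vars F \<inter> vars G = {}"
  shows "steps P One \<longleftrightarrow>
    (\<exists>\<sigma> :: nat \<Rightarrow> (nat, 'c) mlla.
      (\<forall>x \<in> vars G. \<sigma> x = Var x) \<and> MLL {#inst \<sigma> (lolli F G)#})"
proof -
  obtain x where G: "G = Parr (NVar x) (Var x)" using assms(2) by cases auto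
  have inst: "inst \<sigma> (lolli F G) = lolli (inst \<sigma> F) G" if "\<forall>y \<in> vars G. \<sigma> y = Var y" for \<sigma>
    using that by (simp add: lolli_def inst_neg G)
  show ?thesis
  proof
    assume "steps P One"
    then have "sim TYPE(nat) P One" by (rule steps_imp_sim)
    moreover have "transl One G" using transl.One[of "Var x"] by (simp add: G)
    ultimately obtain A where "transl P A" "A \<turnstile> G" unfolding sim_def by blast
    then obtain \<sigma> where \<sigma>: "inst \<sigma> F \<turnstile> G" using transl_imp_inst assms(1) by blast
    \<comment> \<open>The substitution obtained for \<open>F\<close> may move the variable of
      \<open>G\<close>; resetting it leaves \<open>inst \<sigma> F\<close> unchanged by
      disjointness.\<close>
    let ?\<tau> = "\<lambda>y. if y \<in> vars G then Var y else \<sigma> y"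
    have "inst ?\<tau> F = inst \<sigma> F" using assms(3) by (intro inst_cong) auto
    then have "MLL {#inst ?\<tau> (lolli F G)#}"
      using \<sigma> inst[of ?\<tau>] unfolding lolli_def entails_def by (auto intro: MLL.parr)
    then show "\<exists>\<sigma>. (\<forall>x \<in> vars G. \<sigma> x = Var x) \<and> MLL {#inst \<sigma> (lolli F G)#}"
      by (intro exI[of _ ?\<tau>]) auto
  next
    assume "\<exists>\<sigma>. (\<forall>x \<in> vars G. \<sigma> x = Var x) \<and> MLL {#inst \<sigma> (lolli F G)#}"
    then show "steps P One"
      using inst async_imp_transl[OF assms(1)] transl_MLL_imp_steps G by metis
  qed
qed

end
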